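(* Let $(\mathcal{A}^{\mathbb{Z}},F)$ be a bipermutative cellular automaton of smallest neighborhood $\mathbb{U}=[r,s]$, and let $\mu$ be an $(F,\sigma)$-invariant Borel probability measure on $\mathcal{A}^{\mathbb{Z}}$. Then $$h_\mu(F)=\begin{cases} s\,h_\mu(\sigma) & \text{if } s\ge r\ge 0,\\ (s-r)\,h_\mu(\sigma) & \text{if } s\ge 0\ge r,\\ -r\,h_\mu(\sigma) & \text{if } 0\ge s\ge r.\end{cases}$$
   Context: $\mathcal{A}$ is a finite set, $\mathcal{A}^{\mathbb{Z}}$ has the product topology, and $\sigma(x)_i=x_{i+1}$ is the shift. A cellular automaton is a continuous map $F:\mathcal{A}^{\mathbb{Z}}\to\mathcal{A}^{\mathbb{Z}}$ commuting with $\sigma$; equivalently there are a finite interval $\mathbb{U}\subset\mathbb{Z}$ (a neighborhood) and a local rule $\overline{F}:\mathcal{A}^{\mathbb{U}}\to\mathcal{A}$ with $F(x)_m=\overline{F}((x_{m+u})_{u\in\mathbb{U}})$ for all $m$; the smallest such interval is the smallest neighborhood. With smallest neighborhood $[r,s]$, $F$ is left-permutative if for all $u\in\mathcal{A}^{s-r}$, $b\in\mathcal{A}$ there is a unique $a\in\mathcal{A}$ with $\overline{F}(au)=b$; right-permutative if for all such $u,b$ there is a unique $a$ with $\overline{F}(ua)=b$; bipermutative if both. $\mu$ is $(F,\sigma)$-invariant if $\mu(F^{-1}B)=\mu(\sigma^{-1}B)=\mu(B)$ for all Borel $B$. $h_\mu$ denotes Kolmogorov–Sinai entropy. *)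

theory Defs
  imports "HOL-Probability.Probability"
begin

text \<open>Configurations over the alphabet \<^typ>\<open>'a\<close> are functions \<^typ>\<open>int \<Rightarrow> 'a\<close>. For
  \<open>'a :: discrete_topology\<close> the library topology on this type is the product of the discrete
  topologies, and \<open>borel\<close> is its Borel sigma-algebra.\<close>

definition shift_map :: "(int \<Rightarrow> 'a) \<Rightarrow> (int \<Rightarrow> 'a)" where
  "shift_map x = (\<lambda>i. x (i + 1))"

definition cellular_automaton ::
    "((int \<Rightarrow> 'a::{finite, discrete_topology}) \<Rightarrow> (int \<Rightarrow> 'a)) \<Rightarrow> bool" where
  "cellular_automaton F \<longleftrightarrow> continuous_on UNIV F \<and> F \<circ> shift_map = shift_map \<circ> F"

text \<open>A pattern on the interval \<open>[r, s]\<close> is the list of its \<open>s - r + 1\<close> letters from left to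
  right. A local rule is only ever evaluated on lists of that length.\<close>

definition local_rule ::
    "((int \<Rightarrow> 'a) \<Rightarrow> (int \<Rightarrow> 'a)) \<Rightarrow> int \<Rightarrow> int \<Rightarrow> ('a list \<Rightarrow> 'a) \<Rightarrow> bool" where
  "local_rule F r s f \<longleftrightarrow> (\<forall>x m. F x m = f (map (\<lambda>u. x (m + u)) [r..s]))"

definition neighborhood :: "((int \<Rightarrow> 'a) \<Rightarrow> (int \<Rightarrow> 'a)) \<Rightarrow> int \<Rightarrow> int \<Rightarrow> bool" where
  "neighborhood F r s \<longleftrightarrow> r \<le> s \<and> (\<exists>f. local_rule F r s f)"

definition smallest_neighborhood :: "((int \<Rightarrow> 'a) \<Rightarrow> (int \<Rightarrow> 'a)) \<Rightarrow> int \<Rightarrow> int \<Rightarrow> bool" where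
  "smallest_neighborhood F r s \<longleftrightarrow>
     neighborhood F r s \<and> (\<forall>r' s'. neighborhood F r' s' \<longrightarrow> {r..s} \<subseteq> {r'..s'})"

definition left_permutative :: "((int \<Rightarrow> 'a) \<Rightarrow> (int \<Rightarrow> 'a)) \<Rightarrow> bool" where
  "left_permutative F \<longleftrightarrow>
     (\<exists>r s f. smallest_neighborhood F r s \<and> local_rule F r s f \<and>
        (\<forall>u b. length u = nat (s - r) \<longrightarrow> (\<exists>!a. f (a # u) = b)))"

definition right_permutative :: "((int \<Rightarrow> 'a) \<Rightarrow> (int \<Rightarrow> 'a)) \<Rightarrow> bool" where
  "right_permutative F \<longleftrightarrow>
     (\<exists>r s f. smallest_neighborhood F r s \<and> local_rule F r s f \<and>
        (\<forall>u b. length u = nat (s - r) \<longrightarrow> (\<exists>!a. f (u @ [a]) = b)))"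

definition bipermutative :: "((int \<Rightarrow> 'a) \<Rightarrow> (int \<Rightarrow> 'a)) \<Rightarrow> bool" where
  "bipermutative F \<longleftrightarrow> left_permutative F \<and> right_permutative F"

definition finite_measurable_partition :: "'b measure \<Rightarrow> 'b set set \<Rightarrow> bool" where
  "finite_measurable_partition M P \<longleftrightarrow> finite P \<and> P \<subseteq> sets M \<and> partition_on (space M) P"

text \<open>Shannon entropy with the natural logarithm; null atoms contribute \<open>0\<close> since
  \<open>0 * ln 0 = 0\<close>.\<close>

definition partition_entropy :: "'b measure \<Rightarrow> 'b set set \<Rightarrow> real" where
  "partition_entropy M P = - (\<Sum>A\<in>P. measure M A * ln (measure M A))"

definition pullback_partition :: "'b measure \<Rightarrow> ('b \<Rightarrow> 'b) \<Rightarrow> 'b set set \<Rightarrow> 'b set set" where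
  "pullback_partition M T P = (\<lambda>A. T -` A \<inter> space M) ` P - {{}}"

text \<open>The join of the partitions \<open>T\<^sup>-\<^sup>k P\<close> for \<open>k < n\<close>.\<close>

definition dynamical_join :: "'b measure \<Rightarrow> ('b \<Rightarrow> 'b) \<Rightarrow> 'b set set \<Rightarrow> nat \<Rightarrow> 'b set set" where
  "dynamical_join M T P n = common_refinement ((\<lambda>k. pullback_partition M (T ^^ k) P) ` {..<n})"

text \<open>The limit exists (by subadditivity) whenever \<open>T\<close> preserves the probability measure \<open>M\<close>.\<close>

definition entropy_wrt_partition :: "'b measure \<Rightarrow> ('b \<Rightarrow> 'b) \<Rightarrow> 'b set set \<Rightarrow> real" where
  "entropy_wrt_partition M T P = lim (\<lambda>n. partition_entropy M (dynamical_join M T P n) / real n)"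

text \<open>Kolmogorov-Sinai entropy; a supremum in \<^typ>\<open>ereal\<close>, as it may be infinite in general.\<close>

definition ks_entropy :: "'b measure \<Rightarrow> ('b \<Rightarrow> 'b) \<Rightarrow> ereal" where
  "ks_entropy M T =
     (SUP P \<in> {P. finite_measurable_partition M P}. ereal (entropy_wrt_partition M T P))"

end

theory Submission
  imports Defs "HOL-Real_Asymp.Real_Asymp"
begin

text \<open>Let \<open>u = max s 0\<close> and \<open>l = min r 0\<close>; the three cases of the claim all read
  \<open>h(F) = (u - l) h(\<sigma>)\<close>. Bipermutativity implies that the coordinates of
  \<open>x, F x, \<dots>, F\<^sup>n x\<close> in a window \<open>[a, b)\<close> of length at least \<open>u - l\<close> carry the same
  information as the coordinates of \<open>x\<close> in \<open>[a + n l, b + n u)\<close>. By shift invariance the entropy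
  of the latter depends only on its length \<open>b - a + n (u - l)\<close> and grows like \<open>n (u - l) h(\<sigma>)\<close>.
  Central windows generate the Borel sets, so by the Kolmogorov--Sinai theorem they suffice to
  compute \<open>h(F)\<close>; the shift itself is the case \<open>r = s = 1\<close>.\<close>

section \<open>Subadditive sequences\<close>

text \<open>Carrying the same information is made literal: functions with the same kernel have the
  same entropy, so comparing entropies reduces to equivalences between equalities of letters. The
  zeros in \<open>u\<close> and \<open>l\<close> come from time 0: the window of \<open>x\<close>
  itself is observed, so a neighborhood on one side of 0 cannot move the known interval away from
  it. Bipermutativity acts by cancelling an outermost letter: it extends the known interval of
  \<open>x\<close> by one cell once the other cells of the neighborhood are known, which is the
  origin of the length requirement. Shorter windows can be discarded, since the Kolmogorov--Sinai
  theorem only looks at large ones. That theorem is proved without conditioning on infinite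
  sigma-algebras: an event of small measure has small binary entropy, and Borel sets are
  approximated by window events because the approximable sets form a sigma-algebra.\<close>

lemma fekete_convergent:
  fixes a :: "nat \<Rightarrow> real"
  assumes nonneg: "\<And>n. 0 \<le> a n"
    and subadd: "\<And>m n. a (m + n) \<le> a m + a n"
  shows "convergent (\<lambda>n. a n / real n)"
proof -
  \<comment> \<open>The infimum is the limit (Fekete): dividing \<open>n\<close> by a
    \<open>p\<close> that nearly attains it leaves a remainder that vanishes after division by
    \<open>n\<close>. It starts at 1, since the quotient at 0 is 0 by convention.\<close>
  define L where "L = (INF n\<in>{1..}. a n / real n)"
  have bdd: "bdd_below ((\<lambda>n. a n / real n) ` {1..})"
    using nonneg by (intro bdd_belowI[of _ 0]) auto
  have L_le: "L \<le> a n / real n" if "n \<ge> 1" for n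
    unfolding L_def using that by (intro cINF_lower[OF bdd]) auto
  have mult: "a (q * p + k) \<le> real q * a p + a k" for p q k
  proof (induction q)
    case (Suc q)
    show ?case
      using subadd[of p "q * p + k"] Suc by (simp add: algebra_simps)
  qed simp
  have "(\<lambda>n. a n / real n) \<longlonglongrightarrow> L"
  proof (rule LIMSEQ_I)
    fix e :: real assume e: "0 < e"
    have "\<exists>p\<in>{1..}. a p / real p < L + e / 2"
      using cINF_less_iff[OF _ bdd, of "L + e / 2"] e unfolding L_def by auto
    then obtain p where p: "p \<ge> 1" "a p / real p < L + e / 2" by auto
    \<comment> \<open>Bounds every remainder \<open>a k\<close> with \<open>k < p\<close>:
      \<open>k\<close> steps of size 1 from \<open>a 0\<close>, which need not vanish.\<close>
    define B where "B = a 0 + real p * a 1"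
    have B0: "0 \<le> B" unfolding B_def using nonneg by simp
    obtain N where N: "real N > 2 * B / e" using reals_Archimedean2 by blast
    show "\<exists>no. \<forall>n\<ge>no. norm (a n / real n - L) < e"
    proof (intro exI allI impI)
      fix n assume n: "n \<ge> Suc N"
      have n0: "real n > 0" using n by simp
      define q where "q = n div p"
      define k where "k = n mod p"
      have nqk: "n = q * p + k" unfolding q_def k_def by simp
      have k: "k < p" unfolding k_def using p by simp
      have "a k \<le> a 0 + real k * a 1" using mult[of k 1 0] by simp
      also have "\<dots> \<le> B" unfolding B_def using k nonneg by (simp add: mult_right_mono)
      finally have "a n \<le> real q * a p + B" using mult[of q p k] nqk by simp
      also have "real q * a p = (real q * real p) * (a p / real p)" using p by simp
      also have "\<dots> \<le> real n * (a p / real p)"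
      proof (rule mult_right_mono)
        show "real q * real p \<le> real n" by (subst nqk) simp
      qed (use nonneg in simp)
      finally have "a n / real n \<le> a p / real p + B / real n"
        using n0 by (simp add: field_simps)
      moreover have "B / real n < e / 2"
      proof -
        have "2 * B / e < real n" using N n by simp
        then show ?thesis using e n0 by (simp add: field_simps)
      qed
      ultimately have "a n / real n < L + e" using p by linarith
      moreover have "L \<le> a n / real n" using L_le n by simp
      ultimately show "norm (a n / real n - L) < e" by simp
    qed
  qed
  then show ?thesis by (rule convergentI)
qed

section \<open>Entropy of finite-valued functions\<close>

text \<open>Indexing by points instead of values keeps the empty set out, as
  \<open>partition_on\<close> demands, and makes the result depend on the kernel of \<open>X\<close>
  alone, whatever its value type.\<close>

definition fibres :: "'b measure \<Rightarrow> ('b \<Rightarrow> 'c) \<Rightarrow> 'b set set" where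
  "fibres M X = (\<lambda>x. X -` {X x} \<inter> space M) ` space M"

definition fibre_entropy :: "'b measure \<Rightarrow> ('b \<Rightarrow> 'c) \<Rightarrow> real" where
  "fibre_entropy M X = partition_entropy M (fibres M X)"

lemma fibres_cong:
  assumes "\<And>x y. x \<in> space M \<Longrightarrow> y \<in> space M \<Longrightarrow> X x = X y \<longleftrightarrow> Y x = Y y"
  shows "fibres M X = fibres M Y"
proof -
  have "X -` {X x} \<inter> space M = Y -` {Y x} \<inter> space M" if "x \<in> space M" for x
    using assms[OF _ that] by auto
  then show ?thesis unfolding fibres_def by (rule image_cong[OF refl])
qed

lemma fibre_entropy_cong:
  assumes "\<And>x y. x \<in> space M \<Longrightarrow> y \<in> space M \<Longrightarrow> X x = X y \<longleftrightarrow> Y x = Y y"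
  shows "fibre_entropy M X = fibre_entropy M Y"
  unfolding fibre_entropy_def by (rule arg_cong[OF fibres_cong]) (rule assms)

lemma fibre_entropy_eq_sum:
  "fibre_entropy M X =
     - (\<Sum>v\<in>X ` space M. measure M (X -` {v} \<inter> space M) * ln (measure M (X -` {v} \<inter> space M)))"
proof -
  have "fibres M X = (\<lambda>v. X -` {v} \<inter> space M) ` X ` space M"
    unfolding fibres_def by auto
  moreover have "inj_on (\<lambda>v. X -` {v} \<inter> space M) (X ` space M)"
    by (rule inj_onI) blast
  ultimately show ?thesis
    unfolding fibre_entropy_def partition_entropy_def by (simp add: sum.reindex)
qed

text \<open>Each point is labelled by the atom containing it. This turns the supremum over
  partitions into one over finite-valued functions.\<close>

lemma partition_eq_fibres:
  assumes "finite_measurable_partition M P"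
  obtains X :: "'b \<Rightarrow> 'b set" where "simple_function M X" "P = fibres M X"
proof
  define X where "X x = (THE A. A \<in> P \<and> x \<in> A)" for x
  have part: "partition_on (space M) P" and fin: "finite P" and meas: "P \<subseteq> sets M"
    using assms unfolding finite_measurable_partition_def by auto
  have X: "X x = A" if "A \<in> P" "x \<in> A" for x A
    unfolding X_def
  proof (rule the_equality)
    show "B = A" if "B \<in> P \<and> x \<in> B" for B
      using that \<open>A \<in> P\<close> \<open>x \<in> A\<close> partition_onD2[OF part] unfolding disjoint_def by blast
  qed (use that in blast)
  have ex: "\<exists>A\<in>P. x \<in> A" if "x \<in> space M" for x
    using that partition_onD1[OF part] by blast
  have sub: "A \<subseteq> space M" if "A \<in> P" for A
    using that partition_onD1[OF part] by blast
  have fib: "X -` {A} \<inter> space M = A" if "A \<in> P" for A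
    using X that ex sub by blast
  have img: "X ` space M \<subseteq> P" using X ex by blast
  show "simple_function M X"
    unfolding simple_function_def 
  proof (intro conjI ballI)
    show "finite (X ` space M)" by (rule finite_subset[OF img fin])
    show "X -` {A} \<inter> space M \<in> sets M" if "A \<in> X ` space M" for A
      using that img fib meas by (metis subsetD)
  qed
  show "P = fibres M X"
  proof
    show "P \<subseteq> fibres M X"
    proof
      fix A assume A: "A \<in> P"
      then obtain x where x: "x \<in> A" using partition_onD3[OF part] by fastforce
      then have "A = X -` {X x} \<inter> space M" using X[OF A x] fib[OF A] by simp
      then show "A \<in> fibres M X" unfolding fibres_def using x sub[OF A] by blast
    qed
    show "fibres M X \<subseteq> P"
      unfolding fibres_def using img fib by fastforce
  qed
qed

lemma partition_on_fibres: "partition_on (space M) (fibres M X)"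
  unfolding partition_on_def disjoint_def fibres_def by auto

lemma finite_measurable_partition_fibres:
  assumes "simple_function M X"
  shows "finite_measurable_partition M (fibres M X)"
proof -
  have "finite (fibres M X)"
  proof -
    have "fibres M X = (\<lambda>v. X -` {v} \<inter> space M) ` X ` space M"
      unfolding fibres_def by auto
    then show ?thesis using assms unfolding simple_function_def by simp
  qed
  moreover have "fibres M X \<subseteq> sets M"
    using assms unfolding simple_function_def fibres_def by auto
  ultimately show ?thesis
    using partition_on_fibres unfolding finite_measurable_partition_def by blast
qed

lemma simple_function_map:
  assumes "\<And>i. i \<in> set xs \<Longrightarrow> simple_function M (X i)"
  shows "simple_function M (\<lambda>x. map (\<lambda>i. X i x) xs)"
  using assms
proof (induction xs)
  case (Cons i xs)
  then show ?case
    by (simp add: simple_function_compose2[where h = "(#)"])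
qed simp

lemma simple_function_comp_measurable:
  assumes X: "simple_function M X" and T: "T \<in> measurable M M"
  shows "simple_function M (\<lambda>x. X (T x))"
  unfolding simple_function_def
proof (intro conjI ballI)
  have T': "T x \<in> space M" if "x \<in> space M" for x
    using measurable_space[OF T that] .
  have "(\<lambda>x. X (T x)) ` space M \<subseteq> X ` space M" using T' by blast
  then show "finite ((\<lambda>x. X (T x)) ` space M)"
    using X finite_subset unfolding simple_function_def by blast
  fix v assume "v \<in> (\<lambda>x. X (T x)) ` space M"
  then have "X -` {v} \<inter> space M \<in> sets M"
    using T' X unfolding simple_function_def by blast
  from measurable_sets[OF T this]
  show "(\<lambda>x. X (T x)) -` {v} \<inter> space M \<in> sets M"
    using T' by (simp add: vimage_def Int_def conj_ac cong: conj_cong)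
qed

text \<open>The function records which of finitely many events occur; it will serve as the error
  term when a function is approximated.\<close>

lemma simple_function_Collect_mem:
  assumes "finite V" and "\<And>v. v \<in> V \<Longrightarrow> D v \<in> sets M"
  shows "simple_function M (\<lambda>x. {v \<in> V. x \<in> D v})"
  using assms
proof (induction V rule: finite_induct)
  case (insert v V)
  have "simple_function M (\<lambda>x. (if x \<in> D v then {v} else {}) \<union> {u \<in> V. x \<in> D u})"
  proof (rule simple_function_compose2[where h = "(\<union>)"])
    show "simple_function M (\<lambda>x. if x \<in> D v then {v} else {})"
      unfolding simple_function_def
    proof
      show "finite ((\<lambda>x. if x \<in> D v then {v} else {}) ` space M)"
        by (rule finite_subset[of _ "{{v}, {}}"]) auto
      have "(\<lambda>x. if x \<in> D v then {v} else {}) -` {w} \<inter> space M =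
          (if w = {v} then D v else if w = {} then space M - D v else {})" for w
        using sets.sets_into_space[OF insert.prems[of v]] by (auto split: if_splits)
      then show "\<forall>w\<in>(\<lambda>x. if x \<in> D v then {v} else {}) ` space M.
          (\<lambda>x. if x \<in> D v then {v} else {}) -` {w} \<inter> space M \<in> sets M"
        using insert.prems[of v] by auto
    qed
    show "simple_function M (\<lambda>x. {u \<in> V. x \<in> D u})" using insert by simp
  qed
  moreover have "(\<lambda>x. {u \<in> insert v V. x \<in> D u}) =
      (\<lambda>x. (if x \<in> D v then {v} else {}) \<union> {u \<in> V. x \<in> D u})"
    by (rule ext) auto
  ultimately show ?case by simp
qed simp

section \<open>Shannon inequalities and the binary entropy function\<close>

context prob_space
begin

text \<open>With base \<open>exp 1\<close> the logarithm \<open>log\<close> is \<open>ln\<close>, so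
  the entropy inequalities of \<open>information_space\<close> apply to
  \<open>partition_entropy\<close>.\<close>

lemma information_space_exp: "information_space M (exp 1)"
  by unfold_locales simp

lemma fibre_entropy_eq_entropy:
  assumes "simple_function M X"
  shows "fibre_entropy M X = entropy (exp 1) (count_space (X ` space M)) X"
proof -
  interpret information_space M "exp 1" by (rule information_space_exp)
  show ?thesis
    by (subst entropy_simple_distributed[OF simple_distributedI[OF assms measure_nonneg refl]])
       (simp only: fibre_entropy_eq_sum log_def ln_exp div_by_1)
qed

lemma fibre_entropy_nonneg: "0 \<le> fibre_entropy M X"
proof -
  have "measure M A * ln (measure M A) \<le> 0" for A
  proof (cases "measure M A = 0")
    case False
    then have "0 < measure M A" by (simp add: zero_less_measure_iff)
    then show ?thesis by (simp add: mult_nonneg_nonpos)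
  qed simp
  then show ?thesis
    unfolding fibre_entropy_eq_sum by (simp add: sum_nonpos)
qed

lemma fibre_entropy_mono:
  assumes X: "simple_function M X"
    and det: "\<And>x y. x \<in> space M \<Longrightarrow> y \<in> space M \<Longrightarrow> X x = X y \<Longrightarrow> Y x = Y y"
  shows "fibre_entropy M Y \<le> fibre_entropy M X"
proof -
  interpret information_space M "exp 1" by (rule information_space_exp)
  \<comment> \<open>\<open>f\<close> evaluates \<open>Y\<close> at a chosen representative of each
    fibre of \<open>X\<close>. Thus \<open>Y\<close> factors through \<open>X\<close> on
    \<open>space M\<close>, and data processing applies.\<close>
  define f where "f v = Y (SOME x. x \<in> space M \<and> X x = v)" for v
  have f: "(f \<circ> X) x = Y x" if "x \<in> space M" for x
  proof -
    have "(SOME y. y \<in> space M \<and> X y = X x) \<in> space M \<and>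
        X (SOME y. y \<in> space M \<and> X y = X x) = X x"
      by (rule someI[of "\<lambda>y. y \<in> space M \<and> X y = X x" x]) (simp add: that)
    then show ?thesis unfolding f_def comp_def by (intro det) (use that in auto)
  qed
  have "fibre_entropy M Y = fibre_entropy M (f \<circ> X)"
    by (rule fibre_entropy_cong) (metis f)
  also have "\<dots> = entropy (exp 1) (count_space ((f \<circ> X) ` space M)) (f \<circ> X)"
    by (rule fibre_entropy_eq_entropy[OF simple_function_compose[OF X]])
  also have "\<dots> \<le> entropy (exp 1) (count_space (X ` space M)) X" by (rule entropy_data_processing[OF X])
  also have "\<dots> = fibre_entropy M X" by (rule fibre_entropy_eq_entropy[OF X, symmetric])
  finally show ?thesis .
qed

text \<open>The chain rule splits off the entropy of \<open>Y\<close> given \<open>X\<close>, and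
  conditioning does not increase entropy.\<close>

lemma fibre_entropy_Pair_le:
  assumes X: "simple_function M X" and Y: "simple_function M Y"
  shows "fibre_entropy M (\<lambda>x. (X x, Y x)) \<le> fibre_entropy M X + fibre_entropy M Y"
proof -
  interpret information_space M "exp 1" by (rule information_space_exp)
  show ?thesis
    using entropy_chain_rule[OF X Y] conditional_entropy_less_eq_entropy[OF Y X]
      fibre_entropy_eq_entropy[OF X] fibre_entropy_eq_entropy[OF Y]
      fibre_entropy_eq_entropy[OF simple_function_Pair[OF X Y]]
    by linarith
qed

lemma fibre_entropy_le_add:
  assumes X: "simple_function M X" and Y: "simple_function M Y"
    and det: "\<And>x y. x \<in> space M \<Longrightarrow> y \<in> space M \<Longrightarrow> X x = X y \<Longrightarrow> Y x = Y y \<Longrightarrow> Z x = Z y"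
  shows "fibre_entropy M Z \<le> fibre_entropy M X + fibre_entropy M Y"
proof -
  have "fibre_entropy M Z \<le> fibre_entropy M (\<lambda>x. (X x, Y x))"
    by (rule fibre_entropy_mono[OF simple_function_Pair[OF X Y]]) (rule det, simp_all)
  with fibre_entropy_Pair_le[OF X Y] show ?thesis by simp
qed

lemma fibre_entropy_const:
  assumes "\<And>x y. x \<in> space M \<Longrightarrow> y \<in> space M \<Longrightarrow> X x = X y"
  shows "fibre_entropy M X = 0"
proof -
  have "fibre_entropy M X = fibre_entropy M (\<lambda>x. ())"
    by (rule fibre_entropy_cong) (rule iffI[OF refl], erule (1) assms)
  also have "\<dots> = 0"
    by (simp add: fibre_entropy_eq_sum image_constant_conv prob_space)
  finally show ?thesis .
qed

lemma fibre_entropy_Collect_mem_le: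
  assumes "finite V" and "\<And>v. v \<in> V \<Longrightarrow> D v \<in> sets M"
  shows "fibre_entropy M (\<lambda>x. {v \<in> V. x \<in> D v}) \<le> (\<Sum>v\<in>V. fibre_entropy M (\<lambda>x. x \<in> D v))"
  using assms
proof (induction V rule: finite_induct)
  case empty
  show ?case by (simp add: fibre_entropy_const)
next
  case (insert v V)
  have sf: "simple_function M (\<lambda>x. x \<in> D v)"
  proof -
    have "simple_function M (\<lambda>x. v \<in> {u \<in> {v}. x \<in> D u})"
      by (rule simple_function_compose1[OF simple_function_Collect_mem]) (use insert in auto)
    then show ?thesis by simp
  qed
  have "fibre_entropy M (\<lambda>x. {u \<in> insert v V. x \<in> D u})
      \<le> fibre_entropy M (\<lambda>x. x \<in> D v) + fibre_entropy M (\<lambda>x. {u \<in> V. x \<in> D u})"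
  proof (rule fibre_entropy_le_add[OF sf simple_function_Collect_mem])
    show "{u \<in> insert v V. x \<in> D u} = {u \<in> insert v V. y \<in> D u}"
      if "(x \<in> D v) = (y \<in> D v)" "{u \<in> V. x \<in> D u} = {u \<in> V. y \<in> D u}" for x y
      using that by blast
  qed (use insert in auto)
  with insert show ?case by simp
qed

lemma fibre_entropy_mem:
  assumes "A \<in> sets M"
  shows "fibre_entropy M (\<lambda>x. x \<in> A) =
    - (prob A * ln (prob A)) - (1 - prob A) * ln (1 - prob A)"
proof -
  define g where "g v = prob ((\<lambda>x. x \<in> A) -` {v} \<inter> space M)" for v
  have T: "(\<lambda>x. x \<in> A) -` {True} \<inter> space M = A"
    using sets.sets_into_space[OF assms] by auto
  have F: "(\<lambda>x. x \<in> A) -` {False} \<inter> space M = space M - A" by auto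
  \<comment> \<open>A truth value that is not attained has the empty fibre and contributes
    \<open>0 * ln 0 = 0\<close>, so the formula also covers \<open>A\<close> empty or full.\<close>
  have "(\<Sum>v\<in>(\<lambda>x. x \<in> A) ` space M. g v * ln (g v)) = (\<Sum>v\<in>UNIV. g v * ln (g v))"
  proof (rule sum.mono_neutral_left)
    show "\<forall>v\<in>UNIV - (\<lambda>x. x \<in> A) ` space M. g v * ln (g v) = 0"
    proof
      fix v assume "v \<in> UNIV - (\<lambda>x. x \<in> A) ` space M"
      then have "(\<lambda>x. x \<in> A) -` {v} \<inter> space M = {}" by blast
      then show "g v * ln (g v) = 0" unfolding g_def by simp
    qed
  qed auto
  also have "\<dots> = g True * ln (g True) + g False * ln (g False)"
    by (simp add: UNIV_bool)
  finally show ?thesis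
    unfolding fibre_entropy_eq_sum g_def T F by (simp add: prob_compl[OF assms])
qed

lemma fibre_entropy_mem_small:
  assumes "0 < e"
  obtains d where "0 < d" "\<And>A. A \<in> sets M \<Longrightarrow> prob A < d \<Longrightarrow> fibre_entropy M (\<lambda>x. x \<in> A) < e"
proof -
  have "((\<lambda>p::real. - (p * ln p) - (1 - p) * ln (1 - p)) \<longlongrightarrow> 0) (at_right 0)"
    by real_asymp
  from tendstoD[OF this assms]
  obtain d :: real where d: "0 < d"
    "\<And>p. 0 < p \<Longrightarrow> p < d \<Longrightarrow> \<bar>- (p * ln p) - (1 - p) * ln (1 - p)\<bar> < e"
    unfolding eventually_at_right_field dist_real_def by force
  show thesis
  proof (rule that[OF d(1)])
    fix A assume A: "A \<in> sets M" "prob A < d"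
    show "fibre_entropy M (\<lambda>x. x \<in> A) < e"
    \<comment> \<open>The limit from the right says nothing at probability 0, where the entropy is
      exactly 0.\<close>
    proof (cases "prob A = 0")
      case False
      then have "0 < prob A" by (simp add: zero_less_measure_iff)
      with d(2)[OF this A(2)] show ?thesis by (simp add: fibre_entropy_mem[OF A(1)])
    qed (simp add: fibre_entropy_mem[OF A(1)] assms)
  qed
qed

end

section \<open>Generating sequences of finite-valued functions\<close>

locale finite_filtration = prob_space M for M :: "'b measure" +
  fixes Q :: "nat \<Rightarrow> 'b \<Rightarrow> 'c"
  assumes simple: "\<And>m. simple_function M (Q m)"
    and determines: "\<And>m m' x y. m \<le> m' \<Longrightarrow> x \<in> space M \<Longrightarrow> y \<in> space M \<Longrightarrow>
      Q m' x = Q m' y \<Longrightarrow> Q m x = Q m y"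
begin

definition approximable :: "'b set \<Rightarrow> bool" where
  "approximable A \<longleftrightarrow> A \<in> sets M \<and>
     (\<forall>e>0. \<exists>m S. prob (sym_diff A (Q m -` S \<inter> space M)) < e)"

lemma event_sets: "Q m -` S \<inter> space M \<in> sets M"
  by (rule simple_functionD(2)[OF simple])

text \<open>\<open>Q m'\<close> determines \<open>Q m\<close>, so the image of the event under
  \<open>Q m'\<close> pulls back to the event itself and nothing more.\<close>

lemma event_mono:
  assumes "m \<le> m'"
  shows "\<exists>S'. Q m -` S \<inter> space M = Q m' -` S' \<inter> space M"
proof
  show "Q m -` S \<inter> space M = Q m' -` (Q m' ` (Q m -` S \<inter> space M)) \<inter> space M"
  proof (intro equalityI subsetI)
    fix x assume "x \<in> Q m' -` (Q m' ` (Q m -` S \<inter> space M)) \<inter> space M"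
    then obtain y where y: "y \<in> space M" "Q m y \<in> S" "Q m' x = Q m' y" "x \<in> space M" by auto
    have "Q m x = Q m y" by (rule determines[OF assms y(4,1,3)])
    with y show "x \<in> Q m -` S \<inter> space M" by simp
  qed auto
qed

lemma approximable_Compl:
  assumes "approximable A"
  shows "approximable (space M - A)"
  unfolding approximable_def
proof (intro conjI allI impI)
  show "space M - A \<in> sets M" using assms unfolding approximable_def by auto
  fix e :: real assume "0 < e"
  then obtain m S where mS: "prob (sym_diff A (Q m -` S \<inter> space M)) < e"
    using assms unfolding approximable_def by blast
  have "A \<subseteq> space M"
    using assms sets.sets_into_space unfolding approximable_def by blast
  then have "sym_diff (space M - A) (Q m -` (- S) \<inter> space M) = sym_diff A (Q m -` S \<inter> space M)"
    by blast
  with mS show "\<exists>m S. prob (sym_diff (space M - A) (Q m -` S \<inter> space M)) < e" by metis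
qed

text \<open>Approximations at different levels can all be moved to the maximum of the levels. A
  common level is what lets a single \<open>Q m\<close> approximate all fibres of a
  function.\<close>

lemma approximable_finite_family:
  assumes "finite I" and "\<And>i. i \<in> I \<Longrightarrow> approximable (A i)" and "0 < e"
  shows "\<exists>m. \<exists>S. \<forall>i\<in>I. prob (sym_diff (A i) (Q m -` S i \<inter> space M)) < e"
  using assms(1,2)
proof (induction I rule: finite_induct)
  case (insert j I)
  obtain m S where mS: "\<forall>i\<in>I. prob (sym_diff (A i) (Q m -` S i \<inter> space M)) < e"
    using insert by auto
  obtain m' S' where m'S': "prob (sym_diff (A j) (Q m' -` S' \<inter> space M)) < e"
    using insert.prems[of j] assms(3) unfolding approximable_def by auto
  have "\<forall>i. \<exists>R. Q m -` S i \<inter> space M = Q (max m m') -` R \<inter> space M"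
    using event_mono[of m "max m m'"] by simp
  then obtain R where R: "\<And>i. Q m -` S i \<inter> space M = Q (max m m') -` R i \<inter> space M"
    by metis
  obtain R' where R': "Q m' -` S' \<inter> space M = Q (max m m') -` R' \<inter> space M"
    using event_mono[of m' "max m m'" S'] by auto
  show ?case
  proof (intro exI ballI)
    fix i assume "i \<in> insert j I"
    then show "prob (sym_diff (A i) (Q (max m m') -` (R(j := R')) i \<inter> space M)) < e"
      by (cases "i = j") (use mS m'S' in \<open>simp_all add: R[symmetric] R'[symmetric]\<close>)
  qed
qed auto

text \<open>Continuity from below replaces the union by one member of the sequence at cost
  \<open>e / 2\<close>; approximating that member costs the other half.\<close>

lemma approximable_incseq:
  assumes app: "\<And>n::nat. approximable (A n)" and inc: "incseq A"
  shows "approximable (\<Union>n. A n)"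
  unfolding approximable_def
proof (intro conjI allI impI)
  have sets: "A n \<in> sets M" for n using app unfolding approximable_def by blast
  then show U: "(\<Union>n. A n) \<in> sets M" by blast
  fix e :: real assume e: "0 < e"
  have "(\<lambda>n. prob (A n)) \<longlonglongrightarrow> prob (\<Union>n. A n)"
    using sets inc by (intro finite_Lim_measure_incseq) auto
  then obtain n where "norm (prob (A n) - prob (\<Union>n. A n)) < e / 2"
    using LIMSEQ_D[of _ _ "e / 2"] e by (metis half_gt_zero order_refl)
  moreover have "prob ((\<Union>n. A n) - A n) = prob (\<Union>n. A n) - prob (A n)"
    using U sets by (intro finite_measure_Diff) auto
  ultimately have small: "prob ((\<Union>n. A n) - A n) < e / 2"
    by (simp only: real_norm_def abs_less_iff) linarith
  obtain m S where mS: "prob (sym_diff (A n) (Q m -` S \<inter> space M)) < e / 2"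
    using app[of n] half_gt_zero[OF e] unfolding approximable_def by blast
  have "prob (sym_diff (\<Union>n. A n) (Q m -` S \<inter> space M))
      \<le> prob (((\<Union>n. A n) - A n) \<union> sym_diff (A n) (Q m -` S \<inter> space M))"
    using U sets event_sets[of m S] by (intro finite_measure_mono) auto
  also have "\<dots> \<le> prob ((\<Union>n. A n) - A n) + prob (sym_diff (A n) (Q m -` S \<inter> space M))"
    using U sets event_sets[of m S] by (intro measure_Un_le) auto
  also have "\<dots> < e" using small mS by simp
  finally show "\<exists>m S. prob (sym_diff (\<Union>n. A n) (Q m -` S \<inter> space M)) < e" by blast
qed

lemma approximable_finite_UN:
  assumes "finite I" and "\<And>i. i \<in> I \<Longrightarrow> approximable (A i)"
  shows "approximable (\<Union>i\<in>I. A i)"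
  unfolding approximable_def
proof (intro conjI allI impI)
  have sets: "A i \<in> sets M" if "i \<in> I" for i using assms(2)[OF that] unfolding approximable_def by blast
  then show U: "(\<Union>i\<in>I. A i) \<in> sets M" using assms(1) by blast
  fix e :: real assume e: "0 < e"
  \<comment> \<open>The errors add up over \<open>I\<close>; the added 1 keeps the quotient defined
    for empty \<open>I\<close> and the final inequality strict.\<close>
  define d where "d = e / (real (card I) + 1)"
  have d: "0 < d" using e unfolding d_def by simp
  obtain m S where mS: "\<forall>i\<in>I. prob (sym_diff (A i) (Q m -` S i \<inter> space M)) < d"
    using approximable_finite_family[OF assms(1) _ d, of A] assms(2) by blast
  have ev: "sym_diff (A i) (Q m -` S i \<inter> space M) \<in> sets M" if "i \<in> I" for i
    using sets[OF that] event_sets by blast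
  have "prob (sym_diff (\<Union>i\<in>I. A i) (Q m -` (\<Union>i\<in>I. S i) \<inter> space M))
      \<le> prob (\<Union>i\<in>I. sym_diff (A i) (Q m -` S i \<inter> space M))"
  proof (rule finite_measure_mono)
    show "(\<Union>i\<in>I. sym_diff (A i) (Q m -` S i \<inter> space M)) \<in> sets M"
      using ev assms(1) by blast
  qed blast
  also have "\<dots> \<le> (\<Sum>i\<in>I. prob (sym_diff (A i) (Q m -` S i \<inter> space M)))"
    using ev assms(1) by (intro finite_measure_subadditive_finite) auto
  also have "\<dots> \<le> real (card I) * d"
    using mS by (intro sum_bounded_above) (simp add: less_imp_le)
  also have "\<dots> < e" using e unfolding d_def by (simp add: field_simps)
  finally show "\<exists>m S. prob (sym_diff (\<Union>i\<in>I. A i) (Q m -` S \<inter> space M)) < e" by blast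
qed

lemma approximable_sigma_sets:
  assumes "\<And>A. A \<in> G \<Longrightarrow> approximable A" and "A \<in> sigma_sets (space M) G"
  shows "approximable A"
  using assms(2)
proof (induction rule: sigma_sets.induct)
  case (Basic A)
  then show ?case by (rule assms(1))
next
  case Empty
  show ?case
    unfolding approximable_def
  proof (intro conjI allI impI)
    fix e :: real assume "0 < e"
    then have "prob (sym_diff {} (Q 0 -` {} \<inter> space M)) < e" by simp
    then show "\<exists>m S. prob (sym_diff {} (Q m -` S \<inter> space M)) < e" by blast
  qed simp
next
  case (Compl A)
  then show ?case by (intro approximable_Compl)
next
  case (Union A)
  \<comment> \<open>Partial unions make the countable union increasing, so the finite and the
    monotone case combine.\<close>
  have "approximable (\<Union>n. \<Union>i\<le>n. A i)"
  proof (rule approximable_incseq)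
    show "incseq (\<lambda>n. \<Union>i\<le>n. A i)" by (force simp: incseq_def)
    show "approximable (\<Union>i\<le>n. A i)" for n
      using Union by (intro approximable_finite_UN) auto
  qed
  moreover have "(\<Union>n. \<Union>i\<le>n. A i) = (\<Union>n. A n)" by blast
  ultimately show ?case by simp
qed

end

section \<open>Entropy of measure-preserving maps\<close>

definition itinerary :: "('b \<Rightarrow> 'b) \<Rightarrow> ('b \<Rightarrow> 'c) \<Rightarrow> nat \<Rightarrow> 'b \<Rightarrow> 'c list" where
  "itinerary T X n x = map (\<lambda>k. X ((T ^^ k) x)) [0..<n]"

lemma itinerary_eq_iff:
  "itinerary T X n x = itinerary T X n y \<longleftrightarrow> (\<forall>k<n. X ((T ^^ k) x) = X ((T ^^ k) y))"
  unfolding itinerary_def by (auto simp: list_eq_iff_nth_eq)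

locale measure_preserving = prob_space M for M :: "'b measure" +
  fixes T :: "'b \<Rightarrow> 'b"
  assumes measurable_map: "T \<in> measurable M M"
    and emeasure_vimage: "\<And>A. A \<in> sets M \<Longrightarrow> emeasure M (T -` A \<inter> space M) = emeasure M A"
begin

lemma measurable_funpow: "T ^^ k \<in> measurable M M"
  by (rule measurable_compose_n[OF measurable_map])

lemma funpow_space: "x \<in> space M \<Longrightarrow> (T ^^ k) x \<in> space M"
  by (rule measurable_space[OF measurable_funpow])

lemma simple_function_funpow:
  assumes "simple_function M X"
  shows "simple_function M (\<lambda>x. X ((T ^^ k) x))"
  by (rule simple_function_comp_measurable[OF assms measurable_funpow])

lemma simple_function_itinerary:
  assumes "simple_function M X"
  shows "simple_function M (itinerary T X n)"
  unfolding itinerary_def by (intro simple_function_map simple_function_funpow assms)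

lemma fibre_entropy_comp:
  assumes X: "simple_function M X"
  shows "fibre_entropy M (\<lambda>x. X (T x)) = fibre_entropy M X"
proof -
  have T: "T x \<in> space M" if "x \<in> space M" for x
    using measurable_space[OF measurable_map that] .
  define g where "g v = prob (X -` {v} \<inter> space M)" for v
  have g: "prob ((\<lambda>x. X (T x)) -` {v} \<inter> space M) = g v" for v
  proof -
    have "(\<lambda>x. X (T x)) -` {v} \<inter> space M = T -` (X -` {v} \<inter> space M) \<inter> space M"
      using T by auto
    then show ?thesis
      unfolding g_def measure_def
      using emeasure_vimage[OF simple_functionD(2)[OF X]] by simp
  qed
  \<comment> \<open>\<open>T\<close> need not be onto, so \<open>X\<close> may take values that
    \<open>X (T x)\<close> misses; by invariance their fibres are null and contribute 0.\<close>
  have "(\<Sum>v\<in>(\<lambda>x. X (T x)) ` space M. g v * ln (g v)) = (\<Sum>v\<in>X ` space M. g v * ln (g v))"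
  proof (rule sum.mono_neutral_left)
    show "finite (X ` space M)" using X by (rule simple_functionD)
    show "(\<lambda>x. X (T x)) ` space M \<subseteq> X ` space M" using T by blast
    show "\<forall>v\<in>X ` space M - (\<lambda>x. X (T x)) ` space M. g v * ln (g v) = 0"
    proof
      fix v assume "v \<in> X ` space M - (\<lambda>x. X (T x)) ` space M"
      then have "(\<lambda>x. X (T x)) -` {v} \<inter> space M = {}" by blast
      then have "g v = 0" using g[of v] by simp
      then show "g v * ln (g v) = 0" by simp
    qed
  qed
  then show ?thesis unfolding fibre_entropy_eq_sum g by (simp add: g_def)
qed

lemma fibre_entropy_funpow:
  assumes X: "simple_function M X"
  shows "fibre_entropy M (\<lambda>x. X ((T ^^ k) x)) = fibre_entropy M X"
proof (induction k)
  case (Suc k)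
  show ?case
    using fibre_entropy_comp[OF simple_function_funpow[OF X, of k]] Suc
    by (simp add: funpow_swap1)
qed simp

text \<open>Atoms missed by \<open>T ^^ k\<close> pull back to the empty set; deleting
  \<open>{}\<close> in \<open>pullback_partition\<close> matches the fact that every fibre contains
  a point.\<close>

lemma pullback_partition_fibres:
  "pullback_partition M (T ^^ k) (fibres M X) = fibres M (\<lambda>x. X ((T ^^ k) x))"
proof -
  have fib: "(T ^^ k) -` (X -` {v} \<inter> space M) \<inter> space M = (\<lambda>x. X ((T ^^ k) x)) -` {v} \<inter> space M" for v
    using funpow_space by auto
  show ?thesis
  proof (intro equalityI subsetI)
    fix B assume "B \<in> pullback_partition M (T ^^ k) (fibres M X)"
    then obtain z where B: "B = (\<lambda>x. X ((T ^^ k) x)) -` {X z} \<inter> space M" and "B \<noteq> {}"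
      unfolding pullback_partition_def fibres_def image_image fib by blast
    then obtain x where "x \<in> space M" "X ((T ^^ k) x) = X z" by blast
    then show "B \<in> fibres M (\<lambda>x. X ((T ^^ k) x))"
      unfolding B fibres_def by (intro image_eqI[of _ _ x]) auto
  next
    fix B assume "B \<in> fibres M (\<lambda>x. X ((T ^^ k) x))"
    then obtain x where x: "x \<in> space M"
      and B: "B = (\<lambda>x. X ((T ^^ k) x)) -` {X ((T ^^ k) x)} \<inter> space M"
      unfolding fibres_def by blast
    have "B \<in> (\<lambda>z. (\<lambda>x. X ((T ^^ k) x)) -` {X z} \<inter> space M) ` space M"
      unfolding B using funpow_space[OF x] by (rule imageI)
    moreover have "x \<in> B" unfolding B using x by simp
    ultimately show "B \<in> pullback_partition M (T ^^ k) (fibres M X)"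
      unfolding pullback_partition_def fibres_def image_image fib by blast
  qed
qed

text \<open>Refinement becomes a pointwise statement about equal values, so that joins can be
  identified by antisymmetry of \<open>refines\<close>.\<close>

lemma refines_fibres_iff:
  "refines (space M) R (fibres M X) \<longleftrightarrow>
     partition_on (space M) R \<and> (\<forall>A\<in>R. \<forall>x\<in>A. \<forall>y\<in>A. X x = X y)"
proof (cases "partition_on (space M) R")
  case True
  have "(\<exists>Y\<in>fibres M X. A \<subseteq> Y) \<longleftrightarrow> (\<forall>x\<in>A. \<forall>y\<in>A. X x = X y)" if "A \<in> R" for A
  proof -
    have sub: "A \<subseteq> space M" using that True unfolding partition_on_def by blast
    have "A \<noteq> {}" using that True unfolding partition_on_def by blast
    then obtain x where x: "x \<in> A" by blast
    show ?thesis
    proof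
      assume "\<forall>x\<in>A. \<forall>y\<in>A. X x = X y"
      then have "X y = X x" if "y \<in> A" for y using that x by blast
      then have "A \<subseteq> X -` {X x} \<inter> space M" using sub by auto
      then show "\<exists>Y\<in>fibres M X. A \<subseteq> Y" unfolding fibres_def using x sub by blast
    next
      assume "\<exists>Y\<in>fibres M X. A \<subseteq> Y"
      then obtain v where "A \<subseteq> X -` {v}" unfolding fibres_def by blast
      then have "X y = v" if "y \<in> A" for y using that by blast
      then show "\<forall>x\<in>A. \<forall>y\<in>A. X x = X y" by simp
    qed
  qed
  from ball_cong[OF refl this] show ?thesis
    unfolding refines_def by (simp only: True partition_on_fibres simp_thms)
qed (simp add: refines_def)

text \<open>Both sides are the coarsest partition on which all \<open>X ((T ^^ k) x)\<close> with
  \<open>k < n\<close> are constant. The facts about \<open>common_refinement\<close> need a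
  nonempty family, hence \<open>0 < n\<close>.\<close>

lemma dynamical_join_fibres:
  assumes "0 < n"
  shows "dynamical_join M T (fibres M X) n = fibres M (itinerary T X n)"
proof (rule refines_asym)
  define P where "P = (\<lambda>k. fibres M (\<lambda>x. X ((T ^^ k) x))) ` {..<n}"
  have join: "dynamical_join M T (fibres M X) n = common_refinement P"
    unfolding dynamical_join_def P_def pullback_partition_fibres ..
  have part: "partition_on (space M) R" if "R \<in> P" for R
    using that partition_on_fibres unfolding P_def by auto
  have ne: "P \<noteq> {}" using assms unfolding P_def by auto
  show "refines (space M) (fibres M (itinerary T X n)) (dynamical_join M T (fibres M X) n)"
    unfolding join
  proof (rule common_refinement_coarsest[OF part partition_on_fibres _ ne])
    fix R assume "R \<in> P"
    then obtain k where k: "k < n" "R = fibres M (\<lambda>x. X ((T ^^ k) x))" unfolding P_def by auto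
    show "refines (space M) (fibres M (itinerary T X n)) R"
      unfolding k refines_fibres_iff using partition_on_fibres k(1)
      by (auto simp: fibres_def itinerary_eq_iff)
  qed
  have "X ((T ^^ k) x) = X ((T ^^ k) y)" if "A \<in> common_refinement P" "x \<in> A" "y \<in> A" "k < n" for A x y k
  proof -
    have "refines (space M) (common_refinement P) (fibres M (\<lambda>x. X ((T ^^ k) x)))"
      by (rule refines_common_refinement[OF part]) (use that in \<open>auto simp: P_def\<close>)
    then show ?thesis using that unfolding refines_fibres_iff by blast
  qed
  then show "refines (space M) (dynamical_join M T (fibres M X) n) (fibres M (itinerary T X n))"
    unfolding join refines_fibres_iff itinerary_eq_iff
    using partition_on_common_refinement[OF part ne] by blast
qed

lemma entropy_wrt_partition_fibres:
  "entropy_wrt_partition M T (fibres M X) = lim (\<lambda>n. fibre_entropy M (itinerary T X n) / real n)"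
proof -
  have "partition_entropy M (dynamical_join M T (fibres M X) n) / real n =
      fibre_entropy M (itinerary T X n) / real n" for n
    \<comment> \<open>At \<open>n = 0\<close> both quotients are 0, division by zero being
      0.\<close>
    by (cases "n = 0") (simp_all add: dynamical_join_fibres fibre_entropy_def)
  then show ?thesis unfolding entropy_wrt_partition_def by (intro arg_cong[of _ _ lim] ext)
qed

text \<open>The last \<open>n\<close> entries form the itinerary of \<open>(T ^^ m) x\<close>, whose
  entropy equals that of \<open>x\<close> by invariance.\<close>

lemma fibre_entropy_itinerary_add_le:
  assumes X: "simple_function M X"
  shows "fibre_entropy M (itinerary T X (m + n))
      \<le> fibre_entropy M (itinerary T X m) + fibre_entropy M (itinerary T X n)"
proof -
  have "fibre_entropy M (itinerary T X (m + n))
      \<le> fibre_entropy M (itinerary T X m) + fibre_entropy M (\<lambda>x. itinerary T X n ((T ^^ m) x))"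
  proof (rule fibre_entropy_le_add)
    show "simple_function M (itinerary T X m)"
      by (rule simple_function_itinerary[OF X])
    show "simple_function M (\<lambda>x. itinerary T X n ((T ^^ m) x))"
      by (intro simple_function_funpow simple_function_itinerary X)
    fix x y
    assume 1: "itinerary T X m x = itinerary T X m y"
      and 2: "itinerary T X n ((T ^^ m) x) = itinerary T X n ((T ^^ m) y)"
    have "X ((T ^^ k) x) = X ((T ^^ k) y)" if k: "k < m + n" for k
    proof (cases "k < m")
      case False
      then have j: "k = (k - m) + m" "k - m < n" using k by auto
      show ?thesis
        using 2 j(2) unfolding itinerary_eq_iff by (subst (1 2) j(1)) (simp add: funpow_add)
    qed (use 1 in \<open>simp add: itinerary_eq_iff\<close>)
    then show "itinerary T X (m + n) x = itinerary T X (m + n) y" by (simp add: itinerary_eq_iff)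
  qed
  then show ?thesis
    by (simp add: fibre_entropy_funpow simple_function_itinerary X)
qed

text \<open>Subadditivity makes the \<open>lim\<close> in the definition of entropy an actual limit,
  so that inequalities between entropies can be passed through it.\<close>

lemma itinerary_entropy_limit:
  assumes X: "simple_function M X"
  shows "(\<lambda>n. fibre_entropy M (itinerary T X n) / real n) \<longlonglongrightarrow> entropy_wrt_partition M T (fibres M X)"
  unfolding entropy_wrt_partition_fibres convergent_LIMSEQ_iff[symmetric]
  by (intro fekete_convergent fibre_entropy_nonneg fibre_entropy_itinerary_add_le X)

lemma fibre_entropy_itinerary_le:
  assumes X: "simple_function M X"
  shows "fibre_entropy M (itinerary T X n) \<le> real n * fibre_entropy M X"
proof (induction n)
  case 0
  have "fibre_entropy M (itinerary T X 0) = 0"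
    by (rule fibre_entropy_const) (simp add: itinerary_def)
  then show ?case by simp
next
  case (Suc n)
  have "fibre_entropy M (itinerary T X 1) = fibre_entropy M X"
    by (rule fibre_entropy_cong) (simp add: itinerary_def)
  then show ?case
    using fibre_entropy_itinerary_add_le[OF X, of n 1] Suc by (simp add: algebra_simps)
qed

end

locale generating_filtration = finite_filtration M Q + measure_preserving M T
  for M :: "'b measure" and Q :: "nat \<Rightarrow> 'b \<Rightarrow> 'c" and T :: "'b \<Rightarrow> 'b" +
  assumes generating: "\<And>A. A \<in> sets M \<Longrightarrow> approximable A"
begin

text \<open>A finite-valued \<open>X\<close> is determined by \<open>Q m\<close> together with the set of those fibres of \<open>X\<close>
  at which it differs from its approximation by events of \<open>Q m\<close>; the latter has small entropy.\<close>

lemma entropy_wrt_partition_le: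
  assumes X: "simple_function M X"
    and Q: "\<And>m. m0 \<le> m \<Longrightarrow> entropy_wrt_partition M T (fibres M (Q m)) \<le> h"
  shows "entropy_wrt_partition M T (fibres M X) \<le> h"
proof (rule field_le_epsilon)
  fix e :: real assume e: "0 < e"
  define V where "V = X ` space M"
  have V: "finite V" unfolding V_def by (rule simple_functionD[OF X])
  \<comment> \<open>There is one error event per value of \<open>X\<close>; the bound
    \<open>e'\<close> makes their entropies add up to at most \<open>e\<close>.\<close>
  define e' where "e' = e / (real (card V) + 1)"
  have e': "0 < e'" unfolding e'_def using e by simp
  obtain d where d: "0 < d" "\<And>A. A \<in> sets M \<Longrightarrow> prob A < d \<Longrightarrow> fibre_entropy M (\<lambda>x. x \<in> A) < e'"
    using fibre_entropy_mem_small[OF e'] by blast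
  have "\<exists>m. \<exists>S. \<forall>v\<in>V. prob (sym_diff (X -` {v} \<inter> space M) (Q m -` S v \<inter> space M)) < d"
    by (rule approximable_finite_family[OF V _ d(1)]) (intro generating simple_functionD(2)[OF X])
  then obtain m1 S1
    where S1: "\<forall>v\<in>V. prob (sym_diff (X -` {v} \<inter> space M) (Q m1 -` S1 v \<inter> space M)) < d"
    by blast
  \<comment> \<open>The bound \<open>h\<close> is available only from \<open>m0\<close> on, and
    approximations survive passing to a higher level.\<close>
  define m where "m = max m0 m1"
  have "\<forall>v. \<exists>R. Q m1 -` S1 v \<inter> space M = Q m -` R \<inter> space M"
    using event_mono[of m1 m] unfolding m_def by simp
  then obtain S where S: "\<And>v. Q m1 -` S1 v \<inter> space M = Q m -` S v \<inter> space M" by metis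
  define E where "E v = sym_diff (X -` {v} \<inter> space M) (Q m -` S v \<inter> space M)" for v
  have E: "E v \<in> sets M" for v
    unfolding E_def using event_sets simple_functionD(2)[OF X] by blast
  define D where "D x = {v \<in> V. x \<in> E v}" for x
  have D: "simple_function M D"
    unfolding D_def using V E by (rule simple_function_Collect_mem)
  have "fibre_entropy M D \<le> (\<Sum>v\<in>V. fibre_entropy M (\<lambda>x. x \<in> E v))"
    unfolding D_def using V E by (rule fibre_entropy_Collect_mem_le)
  also have "\<dots> \<le> real (card V) * e'"
  proof (rule sum_bounded_above)
    fix v assume "v \<in> V"
    then show "fibre_entropy M (\<lambda>x. x \<in> E v) \<le> e'"
      using d(2)[OF E] S1 S unfolding E_def by (simp add: less_imp_le)
  qed
  also have "\<dots> \<le> e" unfolding e'_def using e by (simp add: field_simps)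
  finally have De: "fibre_entropy M D \<le> e" .
  \<comment> \<open>Whether \<open>X\<close> takes the value \<open>v\<close> at a point is decided
    by the approximating event and by whether the point is an error for \<open>v\<close>. Both agree
    at \<open>x\<close> and \<open>y\<close>; taking \<open>v = X x\<close> suffices.\<close>
  have det: "X x = X y" if "x \<in> space M" "y \<in> space M" "Q m x = Q m y" "D x = D y" for x y
  proof -
    have "X x \<in> V" using that(1) unfolding V_def by simp
    then have "x \<in> E (X x) \<longleftrightarrow> y \<in> E (X x)" using that(4) unfolding D_def by blast
    moreover have "x \<in> Q m -` S (X x) \<longleftrightarrow> y \<in> Q m -` S (X x)" using that(3) by simp
    ultimately have "x \<in> X -` {X x} \<longleftrightarrow> y \<in> X -` {X x}"
      unfolding E_def using that(1,2) by blast
    then show ?thesis by simp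
  qed
  have bound: "fibre_entropy M (itinerary T X n) / real n
      \<le> fibre_entropy M (itinerary T (Q m) n) / real n + e" if "0 < n" for n
  proof -
    have "fibre_entropy M (itinerary T X n)
        \<le> fibre_entropy M (itinerary T (Q m) n) + fibre_entropy M (itinerary T D n)"
    proof (rule fibre_entropy_le_add[OF simple_function_itinerary[OF simple] simple_function_itinerary[OF D]])
      fix x y assume xy: "x \<in> space M" "y \<in> space M"
        "itinerary T (Q m) n x = itinerary T (Q m) n y" "itinerary T D n x = itinerary T D n y"
      have "X ((T ^^ k) x) = X ((T ^^ k) y)" if "k < n" for k
        using xy that by (intro det) (auto simp: itinerary_eq_iff intro: funpow_space)
      then show "itinerary T X n x = itinerary T X n y" by (simp add: itinerary_eq_iff)
    qed
    also have "fibre_entropy M (itinerary T D n) \<le> real n * fibre_entropy M D"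
      by (rule fibre_entropy_itinerary_le[OF D])
    also have "\<dots> \<le> real n * e" using De by (simp add: mult_left_mono)
    finally show ?thesis using that by (simp add: field_simps)
  qed
  have "entropy_wrt_partition M T (fibres M X) \<le> entropy_wrt_partition M T (fibres M (Q m)) + e"
  proof (rule tendsto_le)
    show "(\<lambda>n. fibre_entropy M (itinerary T X n) / real n) \<longlonglongrightarrow> entropy_wrt_partition M T (fibres M X)"
      by (rule itinerary_entropy_limit[OF X])
    show "(\<lambda>n. fibre_entropy M (itinerary T (Q m) n) / real n + e)
        \<longlonglongrightarrow> entropy_wrt_partition M T (fibres M (Q m)) + e"
      by (intro tendsto_add tendsto_const itinerary_entropy_limit[OF simple])
    show "\<forall>\<^sub>F n in sequentially. fibre_entropy M (itinerary T X n) / real n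
        \<le> fibre_entropy M (itinerary T (Q m) n) / real n + e"
      using eventually_gt_at_top[of 0] by eventually_elim (rule bound)
  qed simp
  with Q[of m] show "entropy_wrt_partition M T (fibres M X) \<le> h + e"
    unfolding m_def by simp
qed

text \<open>The approximation bound gives one inequality and \<open>Q m0\<close> attains it.
  Starting at \<open>m0\<close> allows finitely many levels to be ignored.\<close>

theorem ks_entropy_eq:
  assumes "\<And>m. m0 \<le> m \<Longrightarrow> (\<lambda>n. fibre_entropy M (itinerary T (Q m) n) / real n) \<longlonglongrightarrow> h"
  shows "ks_entropy M T = ereal h"
proof -
  have Q: "entropy_wrt_partition M T (fibres M (Q m)) = h" if "m0 \<le> m" for m
    using LIMSEQ_unique[OF itinerary_entropy_limit[OF simple] assms[OF that]] .
  show ?thesis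
    unfolding ks_entropy_def
  proof (rule antisym)
    show "(SUP P\<in>{P. finite_measurable_partition M P}. ereal (entropy_wrt_partition M T P)) \<le> ereal h"
    proof (rule SUP_least)
      fix P assume "P \<in> {P. finite_measurable_partition M P}"
      then obtain X :: "'b \<Rightarrow> 'b set" where X: "simple_function M X" "P = fibres M X"
        using partition_eq_fibres by blast
      show "ereal (entropy_wrt_partition M T P) \<le> ereal h"
        using entropy_wrt_partition_le[OF X(1), of m0 h] Q X(2) by simp
    qed
    have "fibres M (Q m0) \<in> {P. finite_measurable_partition M P}"
      using finite_measurable_partition_fibres[OF simple] by simp
    from SUP_upper[OF this, of "\<lambda>P. ereal (entropy_wrt_partition M T P)"]
    show "ereal h \<le> (SUP P\<in>{P. finite_measurable_partition M P}. ereal (entropy_wrt_partition M T P))"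
      by (simp add: Q)
  qed
qed

end

section \<open>Permutativity and windows\<close>

text \<open>Locality and cancellation of either outermost letter, stated on configurations so that
  no local rule is carried along. For \<open>r = s\<close> the half-open intervals are empty, so
  \<open>F x m\<close> alone determines the letter.\<close>

definition bipermutative_window :: "((int \<Rightarrow> 'a) \<Rightarrow> (int \<Rightarrow> 'a)) \<Rightarrow> int \<Rightarrow> int \<Rightarrow> bool" where
  "bipermutative_window F r s \<longleftrightarrow>
     (\<forall>x y m. (\<forall>i\<in>{m + r..m + s}. x i = y i) \<longrightarrow> F x m = F y m) \<and>
     (\<forall>x y m. (\<forall>i\<in>{m + r<..m + s}. x i = y i) \<longrightarrow> F x m = F y m \<longrightarrow> x (m + r) = y (m + r)) \<and>
     (\<forall>x y m. (\<forall>i\<in>{m + r..<m + s}. x i = y i) \<longrightarrow> F x m = F y m \<longrightarrow> x (m + s) = y (m + s))"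

lemma bipermutative_window_shift_map: "bipermutative_window shift_map 1 1"
  unfolding bipermutative_window_def shift_map_def by auto

text \<open>Left and right permutativity each quantify over their own interval; minimality
  identifies both with the given one.\<close>

lemma smallest_neighborhood_unique:
  assumes "smallest_neighborhood F r s" and "smallest_neighborhood F r' s'"
  shows "r' = r \<and> s' = s"
proof -
  have "{r..s} \<subseteq> {r'..s'}" "{r'..s'} \<subseteq> {r..s}" "r \<le> s" "r' \<le> s'"
    using assms unfolding smallest_neighborhood_def neighborhood_def by blast+
  then show ?thesis by auto
qed

text \<open>Uniqueness of the missing letter is cancellation. The two permutativity conditions
  supply separate rules \<open>f\<close> and \<open>g\<close>, each used to cancel on its own
  side.\<close>

lemma bipermutative_window_if_bipermutative:
  assumes bi: "bipermutative F" and sm: "smallest_neighborhood F r s"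
  shows "bipermutative_window F r s"
proof -
  have rs: "r \<le> s" using sm unfolding smallest_neighborhood_def neighborhood_def by blast
  obtain f where f: "local_rule F r s f"
      "\<And>u b. length u = nat (s - r) \<Longrightarrow> \<exists>!a. f (a # u) = b"
    using bi smallest_neighborhood_unique[OF sm]
    unfolding bipermutative_def left_permutative_def by metis
  obtain g where g: "local_rule F r s g"
      "\<And>u b. length u = nat (s - r) \<Longrightarrow> \<exists>!a. g (u @ [a]) = b"
    using bi smallest_neighborhood_unique[OF sm]
    unfolding bipermutative_def right_permutative_def by metis
  have F: "F x m = f (x (m + r) # map (\<lambda>u. x (m + u)) [r + 1..s])" for x m
    using f(1) rs unfolding local_rule_def by (simp add: upto_rec1)
  have G: "F x m = g (map (\<lambda>u. x (m + u)) [r..s - 1] @ [x (m + s)])" for x m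
    using g(1) rs unfolding local_rule_def by (simp add: upto_rec2)
  show ?thesis
    unfolding bipermutative_window_def
  proof (intro conjI allI impI)
    fix x y :: "int \<Rightarrow> 'a" and m
    assume "\<forall>i\<in>{m + r..m + s}. x i = y i"
    then have "map (\<lambda>u. x (m + u)) [r..s] = map (\<lambda>u. y (m + u)) [r..s]" by simp
    then show "F x m = F y m" using f(1) unfolding local_rule_def by metis
  next
    fix x y :: "int \<Rightarrow> 'a" and m
    assume "\<forall>i\<in>{m + r<..m + s}. x i = y i" and eq: "F x m = F y m"
    then have "map (\<lambda>u. x (m + u)) [r + 1..s] = map (\<lambda>u. y (m + u)) [r + 1..s]" by simp
    moreover have "length (map (\<lambda>u. y (m + u)) [r + 1..s]) = nat (s - r)" by simp
    ultimately show "x (m + r) = y (m + r)" using f(2) eq unfolding F by metis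
  next
    fix x y :: "int \<Rightarrow> 'a" and m
    assume "\<forall>i\<in>{m + r..<m + s}. x i = y i" and eq: "F x m = F y m"
    then have "map (\<lambda>u. x (m + u)) [r..s - 1] = map (\<lambda>u. y (m + u)) [r..s - 1]" by simp
    moreover have "length (map (\<lambda>u. y (m + u)) [r..s - 1]) = nat (s - r)" by simp
    ultimately show "x (m + s) = y (m + s)" using g(2) eq unfolding G by metis
  qed
qed

text \<open>Agreement spreads one cell at a time by cancelling the rightmost letter. If
  \<open>s \<le> 0\<close>, the target does not reach beyond \<open>b\<close> and there is nothing
  to extend.\<close>

lemma agree_extend_right:
  assumes F: "bipermutative_window F r s"
    and len: "max s 0 - min r 0 \<le> b - a"
    and c: "c \<le> a" and d: "s \<le> 0 \<Longrightarrow> d = b"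
    and x: "\<forall>i\<in>{a..<b}. x i = y i"
    and Fx: "\<forall>i\<in>{c..<d}. F x i = F y i"
    and j: "a \<le> j" "j < d + max s 0"
  shows "x j = y j"
proof -
  have "b + int t \<le> d + max s 0 \<Longrightarrow> \<forall>i\<in>{a..<b + int t}. x i = y i" for t
  proof (induction t)
    case (Suc t)
    \<comment> \<open>The neighborhood of cell \<open>m\<close> ends at the new cell
      \<open>b + int t\<close>; by \<open>len\<close> its other cells lie in the interval already
      known.\<close>
    define m where "m = b + int t - s"
    have "0 < s" using Suc.prems d by (cases "s \<le> 0") auto
    have IH: "\<forall>i\<in>{a..<b + int t}. x i = y i" using Suc by simp
    then have "\<forall>i\<in>{m + r..<m + s}. x i = y i" and "m \<in> {c..<d}"
      using \<open>0 < s\<close> Suc.prems len c unfolding m_def by auto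
    then have "x (m + s) = y (m + s)"
      using F Fx unfolding bipermutative_window_def by blast
    then have "x (b + int t) = y (b + int t)" unfolding m_def by simp
    moreover have "i = b + int t \<or> i \<in> {a..<b + int t}" if "i \<in> {a..<b + int (Suc t)}" for i
      using that by auto
    ultimately show ?case using IH by blast
  qed (use x in simp)
  from this[of "nat (d + max s 0 - b)"] show ?thesis
    using x j by (cases "b \<le> d + max s 0") auto
qed

text \<open>The mirror image: the chosen cell has the new position as the left end of its
  neighborhood.\<close>

lemma agree_extend_left:
  assumes F: "bipermutative_window F r s"
    and len: "max s 0 - min r 0 \<le> b - a"
    and d: "b \<le> d" and c: "0 \<le> r \<Longrightarrow> c = a"
    and x: "\<forall>i\<in>{a..<b}. x i = y i"
    and Fx: "\<forall>i\<in>{c..<d}. F x i = F y i"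
    and j: "c + min r 0 \<le> j" "j < b"
  shows "x j = y j"
proof -
  have "c + min r 0 \<le> a - int t \<Longrightarrow> \<forall>i\<in>{a - int t..<b}. x i = y i" for t
  proof (induction t)
    case (Suc t)
    define m where "m = a - int (Suc t) - r"
    have "r < 0" using Suc.prems c by (cases "0 \<le> r") auto
    have IH: "\<forall>i\<in>{a - int t..<b}. x i = y i" using Suc by simp
    then have "\<forall>i\<in>{m + r<..m + s}. x i = y i" and "m \<in> {c..<d}"
      using \<open>r < 0\<close> Suc.prems len d unfolding m_def by auto
    then have "x (m + r) = y (m + r)"
      using F Fx unfolding bipermutative_window_def by blast
    then have "x (a - int (Suc t)) = y (a - int (Suc t))" unfolding m_def by simp
    moreover have "i = a - int (Suc t) \<or> i \<in> {a - int t..<b}" if "i \<in> {a - int (Suc t)..<b}" for i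
      using that by auto
    ultimately show ?case using IH by blast
  qed (use x in simp)
  from this[of "nat (a - (c + min r 0))"] show ?thesis
    using x j by (cases "c + min r 0 \<le> a") auto
qed

text \<open>Splitting off the first step, the induction hypothesis at \<open>F x\<close> and
  \<open>F y\<close> turns later times into agreement on \<open>{c..<d}\<close>. One step of
  \<open>F\<close> remains, widening by \<open>min r 0\<close> and \<open>max s 0\<close>.\<close>

lemma funpow_agree_iff:
  assumes F: "bipermutative_window F r s"
    and len: "max s 0 - min r 0 \<le> b - a"
  shows "(\<forall>k\<le>n. \<forall>i\<in>{a..<b}. (F ^^ k) x i = (F ^^ k) y i) \<longleftrightarrow>
    (\<forall>i\<in>{a + int n * min r 0..<b + int n * max s 0}. x i = y i)"
proof (induction n arbitrary: x y)
  case (Suc n)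
  define c where "c = a + int n * min r 0"
  define d where "d = b + int n * max s 0"
  have cd: "c \<le> a" "b \<le> d" "s \<le> 0 \<Longrightarrow> d = b" "0 \<le> r \<Longrightarrow> c = a"
    unfolding c_def d_def by (auto simp: mult_nonneg_nonpos)
  have "(\<forall>k\<le>Suc n. \<forall>i\<in>{a..<b}. (F ^^ k) x i = (F ^^ k) y i) \<longleftrightarrow>
      (\<forall>i\<in>{a..<b}. x i = y i) \<and> (\<forall>k\<le>n. \<forall>i\<in>{a..<b}. (F ^^ k) (F x) i = (F ^^ k) (F y) i)"
    unfolding less_Suc_eq_le[symmetric] All_less_Suc2 by (simp add: funpow_swap1)
  also have "\<dots> \<longleftrightarrow> (\<forall>i\<in>{a..<b}. x i = y i) \<and> (\<forall>i\<in>{c..<d}. F x i = F y i)"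
    unfolding Suc c_def d_def ..
  also have "\<dots> \<longleftrightarrow> (\<forall>i\<in>{c + min r 0..<d + max s 0}. x i = y i)"
  proof
    assume xy: "(\<forall>i\<in>{a..<b}. x i = y i) \<and> (\<forall>i\<in>{c..<d}. F x i = F y i)"
    show "\<forall>i\<in>{c + min r 0..<d + max s 0}. x i = y i"
    proof
      fix i assume i: "i \<in> {c + min r 0..<d + max s 0}"
      show "x i = y i"
      proof (cases "a \<le> i")
        case True
        with i xy show ?thesis by (intro agree_extend_right[OF F len cd(1,3)]) auto
      next
        case False
        then have "i < b" using len by auto
        with i xy show ?thesis by (intro agree_extend_left[OF F len cd(2,4)]) auto
      qed
    qed
  next
    assume xy: "\<forall>i\<in>{c + min r 0..<d + max s 0}. x i = y i"
    have "F x m = F y m" if "m \<in> {c..<d}" for m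
    proof -
      \<comment> \<open>The minimum and maximum with 0 make the wide interval contain these
        neighborhoods and also the original window.\<close>
      have "{m + r..m + s} \<subseteq> {c + min r 0..<d + max s 0}" using that by auto
      then have "\<forall>i\<in>{m + r..m + s}. x i = y i" using xy by blast
      then show ?thesis using F unfolding bipermutative_window_def by blast
    qed
    moreover have "{a..<b} \<subseteq> {c + min r 0..<d + max s 0}" using cd(1,2) by auto
    then have "\<forall>i\<in>{a..<b}. x i = y i" using xy by blast
    ultimately show "(\<forall>i\<in>{a..<b}. x i = y i) \<and> (\<forall>i\<in>{c..<d}. F x i = F y i)" by blast
  qed
  finally show ?case by (simp add: c_def d_def algebra_simps)
qed simp

section \<open>Windows and the product topology\<close>

definition window :: "int \<Rightarrow> nat \<Rightarrow> (int \<Rightarrow> 'a) \<Rightarrow> 'a list" where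
  "window a n x = map (\<lambda>k. x (a + int k)) [0..<n]"

lemma window_eq_iff: "window a n x = window a n y \<longleftrightarrow> (\<forall>i\<in>{a..<a + int n}. x i = y i)"
proof -
  have "{a..<a + int n} = (\<lambda>k. a + int k) ` {..<n}"
  proof (intro equalityI subsetI)
    fix i assume "i \<in> {a..<a + int n}"
    then show "i \<in> (\<lambda>k. a + int k) ` {..<n}" by (intro image_eqI[of _ _ "nat (i - a)"]) auto
  qed auto
  then show ?thesis unfolding window_def by (auto simp: list_eq_iff_nth_eq)
qed

text \<open>A basic open set restricts finitely many coordinates, all within some
  \<open>[-m, m]\<close>; that interval has \<open>2 m + 1\<close> cells.\<close>

lemma open_window_nbhd:
  fixes U :: "(int \<Rightarrow> 'a::topological_space) set"
  assumes "open U" and "x \<in> U"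
  obtains m where "\<And>y. window (- int m) (Suc (2 * m)) y = window (- int m) (Suc (2 * m)) x \<Longrightarrow> y \<in> U"
proof -
  have "openin (product_topology (\<lambda>i. euclidean) UNIV) U"
    using assms(1) unfolding open_fun_def .
  from product_topology_open_contains_basis[OF this assms(2)]
  obtain X where X: "x \<in> (\<Pi>\<^sub>E i\<in>UNIV. X i)" "finite {i. X i \<noteq> UNIV}" "(\<Pi>\<^sub>E i\<in>UNIV. X i) \<subseteq> U"
    by auto
  \<comment> \<open>The sum of the absolute values of all restricted coordinates dominates each of
    them.\<close>
  obtain m :: nat where m: "\<And>i. X i \<noteq> UNIV \<Longrightarrow> \<bar>i\<bar> \<le> int m"
  proof
    fix i assume "X i \<noteq> UNIV"
    then have "nat \<bar>i\<bar> \<le> (\<Sum>i\<in>{i. X i \<noteq> UNIV}. nat \<bar>i\<bar>)"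
      using X(2) by (intro member_le_sum) auto
    then show "\<bar>i\<bar> \<le> int (\<Sum>i\<in>{i. X i \<noteq> UNIV}. nat \<bar>i\<bar>)" by linarith
  qed
  show thesis
  proof
    fix y assume y: "window (- int m) (Suc (2 * m)) y = window (- int m) (Suc (2 * m)) x"
    have "y i \<in> X i" for i
    proof (cases "X i = UNIV")
      case False
      then have "y i = x i" using y m[OF False] unfolding window_eq_iff by (simp add: abs_le_iff)
      then show ?thesis using X(1) by auto
    qed simp
    then show "y \<in> U" using X(3) by auto
  qed
qed

section \<open>Shift-invariant measures\<close>

lemma continuous_on_shift_map:
  "continuous_on UNIV (shift_map :: (int \<Rightarrow> 'a::topological_space) \<Rightarrow> _)"
  unfolding shift_map_def
  by (intro continuous_on_coordinatewise_then_product continuous_on_product_coordinates)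

lemma shift_map_funpow: "(shift_map ^^ k) x i = x (i + int k)"
  by (induction k arbitrary: x i) (simp_all add: shift_map_def algebra_simps)

locale shift_invariant = prob_space M
  for M :: "(int \<Rightarrow> 'a::{finite, discrete_topology}) measure" +
  assumes sets_eq: "sets M = sets borel"
    and shift: "\<And>B. B \<in> sets borel \<Longrightarrow> emeasure M (shift_map -` B) = emeasure M B"
begin

lemma space_eq: "space M = UNIV"
  using sets_eq_imp_space_eq[OF sets_eq] by simp

lemma simple_function_window: "simple_function M (window a n)"
  unfolding window_def
proof (rule simple_function_map)
  fix k
  show "simple_function M (\<lambda>x. x (a + int k))"
    unfolding simple_function_def
  proof (intro conjI ballI)
    fix v :: 'a
    have "open ((\<lambda>x. x (a + int k)) -` {v})"
      by (intro open_vimage discrete_topology_class.open_discrete continuous_on_product_coordinates)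
    then show "(\<lambda>x. x (a + int k)) -` {v} \<inter> space M \<in> sets M"
      unfolding sets_eq space_eq by simp
  qed simp
qed

sublocale finite_filtration M "\<lambda>m. window (- int m) (Suc (2 * m))"
proof unfold_locales
  fix m m' :: nat and x y :: "int \<Rightarrow> 'a"
  assume "m \<le> m'" "window (- int m') (Suc (2 * m')) x = window (- int m') (Suc (2 * m')) y"
  then show "window (- int m) (Suc (2 * m)) x = window (- int m) (Suc (2 * m)) y"
    unfolding window_eq_iff by auto
qed (rule simple_function_window)

lemma approximable_event: "approximable (window (- int m) (Suc (2 * m)) -` S)"
  unfolding approximable_def
proof (intro conjI allI impI exI)
  show "window (- int m) (Suc (2 * m)) -` S \<in> sets M"
    using event_sets[of m S] by (simp add: space_eq)
  show "prob (sym_diff (window (- int m) (Suc (2 * m)) -` S) (window (- int m) (Suc (2 * m)) -` S \<inter> space M)) < e"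
    if "0 < e" for e
    using that by (simp add: space_eq)
qed

lemma approximable_open:
  assumes "open U"
  shows "approximable U"
proof -
  \<comment> \<open>The points whose central window already forces membership in \<open>U\<close>:
    the largest event of that window inside \<open>U\<close>. These events increase to
    \<open>U\<close>.\<close>
  define A where "A m = window (- int m) (Suc (2 * m)) -`
    {v. \<forall>y. window (- int m) (Suc (2 * m)) y = v \<longrightarrow> y \<in> U}" for m
  have A: "x \<in> A m \<longleftrightarrow>
      (\<forall>y. window (- int m) (Suc (2 * m)) y = window (- int m) (Suc (2 * m)) x \<longrightarrow> y \<in> U)" for x m
    unfolding A_def by simp
  have "(\<Union>m. A m) = U"
  proof (intro equalityI subsetI)
    fix x assume "x \<in> U"
    then obtain m where "\<And>y. window (- int m) (Suc (2 * m)) y = window (- int m) (Suc (2 * m)) x \<Longrightarrow> y \<in> U"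
      using open_window_nbhd[OF assms] by metis
    then have "x \<in> A m" unfolding A by blast
    then show "x \<in> (\<Union>m. A m)" by blast
  next
    fix x assume "x \<in> (\<Union>m. A m)"
    then obtain m where "x \<in> A m" by blast
    then show "x \<in> U" unfolding A by blast
  qed
  moreover have "approximable (\<Union>m. A m)"
  proof (rule approximable_incseq)
    show "approximable (A m)" for m unfolding A_def by (rule approximable_event)
    show "incseq A"
    proof (rule incseq_SucI, rule subsetI)
      fix m x assume x: "x \<in> A m"
      have "y \<in> U" if "window (- int (Suc m)) (Suc (2 * Suc m)) y =
          window (- int (Suc m)) (Suc (2 * Suc m)) x" for y
      proof -
        have "window (- int m) (Suc (2 * m)) y = window (- int m) (Suc (2 * m)) x"
          by (rule determines[of m "Suc m", OF _ _ _ that]) (simp_all only: space_eq UNIV_I le_Suc_eq simp_thms order_refl)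
        then show ?thesis using x unfolding A by blast
      qed
      then show "x \<in> A (Suc m)" unfolding A by blast
    qed
  qed
  ultimately show ?thesis by simp
qed

lemma approximable_if_sets:
  assumes "A \<in> sets M"
  shows "approximable A"
  by (rule approximable_sigma_sets[of "{S. open S}"])
     (use assms in \<open>simp_all add: approximable_open sets_eq sets_borel space_eq\<close>)

lemma generating_filtrationI:
  assumes "continuous_on UNIV F"
    and "\<And>B. B \<in> sets borel \<Longrightarrow> emeasure M (F -` B) = emeasure M B"
  shows "generating_filtration M (\<lambda>m. window (- int m) (Suc (2 * m))) F"
proof unfold_locales
  have "F \<in> measurable borel borel" using assms(1) by (rule borel_measurable_continuous_onI)
  then show "F \<in> measurable M M" using measurable_cong_sets[OF sets_eq sets_eq] by blast
qed (use assms(2) in \<open>simp_all add: sets_eq space_eq approximable_if_sets\<close>)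

sublocale shift: generating_filtration M "\<lambda>m. window (- int m) (Suc (2 * m))" shift_map
  by (rule generating_filtrationI[OF continuous_on_shift_map shift])

lemma fibre_entropy_window: "fibre_entropy M (window a n) = fibre_entropy M (window 0 n)"
proof -
  have *: "fibre_entropy M (window (b + int k) n) = fibre_entropy M (window b n)" for b k
  proof -
    have "(window (b + int k) n :: (int \<Rightarrow> 'a) \<Rightarrow> 'a list) = (\<lambda>x. window b n ((shift_map ^^ k) x))"
      by (simp add: window_def shift_map_funpow fun_eq_iff algebra_simps)
    then show ?thesis
      by (simp only: shift.fibre_entropy_funpow[OF simple_function_window, of b n k])
  qed
  \<comment> \<open>Iterates of the shift move windows to the right only, so a negative start is
    moved to 0 instead of starting from 0.\<close>
  show ?thesis
    using *[of 0 "nat a"] *[of a "nat (- a)"] by (cases "0 \<le> a") auto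
qed

text \<open>Entropy per letter, kept as a real number so that limits stay out of
  \<open>ereal\<close>. Its equality with \<open>ks_entropy M shift_map\<close> follows from the
  general formula.\<close>

definition entropy_rate :: real where
  "entropy_rate = entropy_wrt_partition M shift_map (fibres M (window 0 1))"

lemma window_entropy_limit:
  "(\<lambda>n. fibre_entropy M (window 0 n) / real n) \<longlonglongrightarrow> entropy_rate"
proof -
  have "fibre_entropy M (itinerary shift_map (window 0 1) n) = fibre_entropy M (window 0 n)" for n
    by (rule fibre_entropy_cong)
       (simp add: itinerary_eq_iff, simp add: window_def shift_map_funpow list_eq_iff_nth_eq)
  with shift.itinerary_entropy_limit[OF simple_function_window[of 0 1]]
  show ?thesis unfolding entropy_rate_def by simp
qed

text \<open>The lengths \<open>L + n * c\<close> run along a subsequence and grow like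
  \<open>c\<close> times \<open>n\<close>. The denominator is \<open>Suc n\<close> because times
  \<open>0\<close> to \<open>n\<close> give \<open>n + 1\<close> observations.\<close>

lemma window_entropy_limit_linear:
  fixes L c :: nat
  assumes "0 < L"
  shows "(\<lambda>n. fibre_entropy M (window 0 (L + n * c)) / real (Suc n)) \<longlonglongrightarrow> real c * entropy_rate"
\<comment> \<open>For an automaton this is \<open>r = s = 0\<close>: the length stays
  \<open>L\<close>, so there is no subsequence, and the quotient tends to 0.\<close>
proof (cases "c = 0")
  case True
  have "(\<lambda>n. fibre_entropy M (window 0 L) / real (Suc n)) \<longlonglongrightarrow> 0"
    by (rule LIMSEQ_Suc[OF lim_const_over_n])
  with True show ?thesis by simp
next
  case False
  define g where "g n = L + n * c" for n
  have "strict_mono g"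
    unfolding g_def using False by (intro strict_monoI) simp
  then have "filterlim g sequentially sequentially" by (rule filterlim_subseq)
  from filterlim_compose[OF window_entropy_limit this]
  have 1: "(\<lambda>n. fibre_entropy M (window 0 (g n)) / real (g n)) \<longlonglongrightarrow> entropy_rate" .
  have 2: "(\<lambda>n. real (g n) / real (Suc n)) \<longlonglongrightarrow> real c"
    unfolding g_def of_nat_add of_nat_mult of_nat_Suc by real_asymp
  have "fibre_entropy M (window 0 (g n)) / real (g n) * (real (g n) / real (Suc n)) =
      fibre_entropy M (window 0 (L + n * c)) / real (Suc n)" for n
  proof -
    have "g n \<noteq> 0" using assms by (simp add: g_def)
    then show ?thesis unfolding g_def[symmetric] by simp
  qed
  with tendsto_mult[OF 1 2] show ?thesis by (simp add: mult.commute)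
qed

theorem ks_entropy_bipermutative_window:
  assumes "continuous_on UNIV F"
    and "\<And>B. B \<in> sets borel \<Longrightarrow> emeasure M (F -` B) = emeasure M B"
    and F: "bipermutative_window F r s"
  shows "ks_entropy M F = ereal (real_of_int (max s 0 - min r 0) * entropy_rate)"
proof -
  interpret F: generating_filtration M "\<lambda>m. window (- int m) (Suc (2 * m))" F
    by (rule generating_filtrationI[OF assms(1,2)])
  define c where "c = nat (max s 0 - min r 0)"
  have c: "int c = max s 0 - min r 0" unfolding c_def by (simp add: max_def min_def)
  show ?thesis
  proof (rule F.ks_entropy_eq[of c])
    \<comment> \<open>From \<open>m = c\<close> on, the central window has length
      \<open>2 m + 1\<close>, at least the \<open>c\<close> that \<open>funpow_agree_iff\<close>
      requires.\<close>
    fix m assume m: "c \<le> m"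
    \<comment> \<open>The itinerary has the kernel of a wider window starting at
      \<open>- int m + int n * min r 0\<close>; shift invariance moves the start to 0.\<close>
    have "fibre_entropy M (itinerary F (window (- int m) (Suc (2 * m))) (Suc n)) =
        fibre_entropy M (window 0 (Suc (2 * m) + n * c))" for n
    proof (rule trans[OF fibre_entropy_cong fibre_entropy_window])
      fix x y :: "int \<Rightarrow> 'a"
      have "max s 0 - min r 0 \<le> - int m + int (Suc (2 * m)) - (- int m)" using m c by linarith
      from funpow_agree_iff[OF F this, of n x y]
      show "itinerary F (window (- int m) (Suc (2 * m))) (Suc n) x =
          itinerary F (window (- int m) (Suc (2 * m))) (Suc n) y \<longleftrightarrow>
        window (- int m + int n * min r 0) (Suc (2 * m) + n * c) x =
          window (- int m + int n * min r 0) (Suc (2 * m) + n * c) y"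
        unfolding itinerary_eq_iff window_eq_iff less_Suc_eq_le
        by (simp add: c algebra_simps)
    qed
    then have "(\<lambda>n. fibre_entropy M (itinerary F (window (- int m) (Suc (2 * m))) (Suc n)) / real (Suc n))
        \<longlonglongrightarrow> real c * entropy_rate"
      using window_entropy_limit_linear[of "Suc (2 * m)" c] by simp
    then show "(\<lambda>n. fibre_entropy M (itinerary F (window (- int m) (Suc (2 * m))) n) / real n)
        \<longlonglongrightarrow> real_of_int (max s 0 - min r 0) * entropy_rate"
      unfolding c[symmetric] of_int_of_nat_eq by (rule LIMSEQ_imp_Suc)
  qed
qed

end

theorem corollary2p3:
  fixes F :: "(int \<Rightarrow> 'a::{finite, discrete_topology}) \<Rightarrow> (int \<Rightarrow> 'a)"
    and r s :: int
    and \<mu> :: "(int \<Rightarrow> 'a) measure"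
  assumes "cellular_automaton F"
    and "bipermutative F"
    and "smallest_neighborhood F r s"
    and "prob_space \<mu>"
    and "sets \<mu> = sets borel"
    and "\<And>B. B \<in> sets borel \<Longrightarrow> emeasure \<mu> (F -` B) = emeasure \<mu> B"
    and "\<And>B. B \<in> sets borel \<Longrightarrow> emeasure \<mu> (shift_map -` B) = emeasure \<mu> B"
  shows "(0 \<le> r \<and> r \<le> s \<longrightarrow> ks_entropy \<mu> F = ereal (real_of_int s) * ks_entropy \<mu> shift_map) \<and>
         (r \<le> 0 \<and> 0 \<le> s \<longrightarrow> ks_entropy \<mu> F = ereal (real_of_int (s - r)) * ks_entropy \<mu> shift_map) \<and>
         (r \<le> s \<and> s \<le> 0 \<longrightarrow> ks_entropy \<mu> F = ereal (real_of_int (- r)) * ks_entropy \<mu> shift_map)"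
proof -
  interpret shift_invariant \<mu>
    using assms(4,5,7) by (intro shift_invariant.intro shift_invariant_axioms.intro)
  have F: "ks_entropy \<mu> F = ereal (real_of_int (max s 0 - min r 0) * entropy_rate)"
  proof (rule ks_entropy_bipermutative_window)
    show "continuous_on UNIV F" using assms(1) unfolding cellular_automaton_def by simp
    show "bipermutative_window F r s"
      by (rule bipermutative_window_if_bipermutative[OF assms(2,3)])
  qed (rule assms(6))
  have "ks_entropy \<mu> shift_map = ereal entropy_rate"
    using ks_entropy_bipermutative_window[OF continuous_on_shift_map shift
        bipermutative_window_shift_map] by simp
  \<comment> \<open>Both entropies are finite, so the products in \<open>ereal\<close> are real;
    where cases overlap, the factors coincide.\<close>
  then show ?thesis unfolding F by (auto simp: max_def min_def)
qed

end
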